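(* Let $p\ge 2$, $n,m,T\ge 1$ be integers. Let $C\in\mathbb{R}^{p\times p}$ be a matrix such that $\mathbb{1}_p$ is an eigenvector of $C$ corresponding to a real eigenvalue $\mu$ of algebraic multiplicity $1$, and all other eigenvalues of $C$ are real and positive. Write $\sigma(C)\setminus\{\mu\}=\{\lambda_1,\dots,\lambda_\ell\}$ (the distinct eigenvalues of $C$ other than $\mu$). Let $A_{\mathrm{true}}\in\mathbb{R}^{n\times n}$, $B_{\mathrm{true}}\in\mathbb{R}^{n\times m}$, and let $\mathcal{D}$ consist of inputs $u(0),\dots,u(T-1)\in\mathbb{R}^m$ and states $x(0),\dots,x(T)\in\mathbb{R}^n$ satisfying $x(k+1)=A_{\mathrm{true}}x(k)+B_{\mathrm{true}}u(k)$ for $k=0,\dots,T-1$, with associated data matrices $U_-,X_-,X_+$ and set of data-consistent systems $\Sigma_{\mathcal D}$. Then the data $\mathcal{D}$ are informative for synchronizability with respect to $C$ if and only if the following two conditions hold: (a) $X_-$ has full row rank. (b) There exist right inverses $(X_-^R)_1,\dots,(X_-^R)_\ell$ of $X_-$ such that $X_+(X_-^R)_i$ is Schur and $$U_-\big(\lambda_i (X_-^R)_j-\lambda_j (X_-^R)_i\big)=0$$ for all $i,j\in\{1,\dots,\ell\}$. Moreover, if right inverses as in (b) exist, then for every $(A,B)\in\Sigma_{\mathcal D}$ the network $$\bm{x}(k+1)=(I_p\otimes A+C\otimes BK)\,\bm{x}(k)$$ is synchronized by the choice $K=\frac{1}{\lambda_1}U_-(X_-^R)_1$.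
   Context: $\mathbb{1}_p\in\mathbb{R}^p$ is the all-ones vector; $\sigma(C)$ is the set of eigenvalues of $C$; $\otimes$ is the Kronecker product. A square matrix is Schur if all its eigenvalues lie in the open unit disc of the complex plane. A right inverse of a real matrix $M$ with $n$ rows is a real matrix $M^R$ with $MM^R=I_n$. Data matrices: $U_-=[u(0)\ u(1)\ \cdots\ u(T-1)]\in\mathbb{R}^{m\times T}$, $X_-=[x(0)\ x(1)\ \cdots\ x(T-1)]\in\mathbb{R}^{n\times T}$, $X_+=[x(1)\ x(2)\ \cdots\ x(T)]\in\mathbb{R}^{n\times T}$. The set of data-consistent systems is $\Sigma_{\mathcal D}=\{(A,B)\in\mathbb{R}^{n\times n}\times\mathbb{R}^{n\times m}: X_+=AX_-+BU_-\}$. The data $\mathcal{D}$ are informative for synchronizability with respect to $C$ if there exists $K\in\mathbb{R}^{m\times n}$ such that $A+\lambda BK$ is Schur for all $\lambda\in\sigma(C)\setminus\{\mu\}$ and all $(A,B)\in\Sigma_{\mathcal D}$. The network $\bm{x}(k+1)=(I_p\otimes A+C\otimes BK)\bm{x}(k)$, with $\bm{x}=(\bm{x}_1^\top,\dots,\bm{x}_p^\top)^\top$ and $\bm{x}_i(k)\in\mathbb{R}^n$, is said to be synchronized if for every trajectory $\bm{x}$ and all $i,j\in\{1,\dots,p\}$, $\lim_{k\to\infty}\big(\bm{x}_i(k)-\bm{x}_j(k)\big)=0$. *)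

theory Defs
  imports
    "Jordan_Normal_Form.Spectral_Radius"
    "Jordan_Normal_Form.DL_Rank"
begin

abbreviation cmat :: "real mat \<Rightarrow> complex mat" where
  "cmat \<equiv> map_mat complex_of_real"

text \<open>Eigenvalues of real matrices are always taken over the complex numbers.\<close>

definition eigvals :: "real mat \<Rightarrow> complex set" where
  "eigvals C = spectrum (cmat C)"

text \<open>Defined for complex matrices, since \<open>A + \<lambda>BK\<close> is complex for nonreal \<open>\<lambda>\<close>.\<close>

definition schur_stable :: "complex mat \<Rightarrow> bool" where
  "schur_stable M \<longleftrightarrow> square_mat M \<and> (\<forall>z \<in> spectrum M. cmod z < 1)"

definition ones_vec :: "nat \<Rightarrow> real vec" where
  "ones_vec p = vec p (\<lambda>_. 1)"

definition full_row_rank :: "real mat \<Rightarrow> bool" where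
  "full_row_rank M \<longleftrightarrow> vec_space.rank (dim_row M) M = dim_row M"

definition right_inverse :: "real mat \<Rightarrow> real mat \<Rightarrow> bool" where
  "right_inverse M R \<longleftrightarrow> R \<in> carrier_mat (dim_col M) (dim_row M) \<and> inverts_mat M R"

definition kronecker :: "real mat \<Rightarrow> real mat \<Rightarrow> real mat" (infixl \<open>\<otimes>\<^sub>K\<close> 70) where
  "A \<otimes>\<^sub>K B = mat (dim_row A * dim_row B) (dim_col A * dim_col B)
     (\<lambda>(i, j). A $$ (i div dim_row B, j div dim_col B) * B $$ (i mod dim_row B, j mod dim_col B))"

text \<open>The sample sequences \<open>u\<close> and \<open>x\<close> are only inspected at times \<open>0, \<dots>, T - 1\<close> and
  \<open>0, \<dots>, T\<close>, respectively.\<close>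

definition U_minus :: "nat \<Rightarrow> nat \<Rightarrow> (nat \<Rightarrow> real vec) \<Rightarrow> real mat" where
  "U_minus m T u = mat_of_cols m (map u [0..<T])"

definition X_minus :: "nat \<Rightarrow> nat \<Rightarrow> (nat \<Rightarrow> real vec) \<Rightarrow> real mat" where
  "X_minus n T x = mat_of_cols n (map x [0..<T])"

definition X_plus :: "nat \<Rightarrow> nat \<Rightarrow> (nat \<Rightarrow> real vec) \<Rightarrow> real mat" where
  "X_plus n T x = mat_of_cols n (map x [1..<Suc T])"

definition consistent_systems ::
  "nat \<Rightarrow> nat \<Rightarrow> nat \<Rightarrow> (nat \<Rightarrow> real vec) \<Rightarrow> (nat \<Rightarrow> real vec) \<Rightarrow> (real mat \<times> real mat) set" where
  "consistent_systems n m T u x =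
     {(A, B). A \<in> carrier_mat n n \<and> B \<in> carrier_mat n m \<and>
        X_plus n T x = A * X_minus n T x + B * U_minus m T u}"

definition informative_sync ::
  "nat \<Rightarrow> nat \<Rightarrow> nat \<Rightarrow> (nat \<Rightarrow> real vec) \<Rightarrow> (nat \<Rightarrow> real vec) \<Rightarrow> real mat \<Rightarrow> real \<Rightarrow> bool" where
  "informative_sync n m T u x C \<mu> \<longleftrightarrow>
     (\<exists>K \<in> carrier_mat m n.
        \<forall>z \<in> eigvals C - {complex_of_real \<mu>}. \<forall>(A, B) \<in> consistent_systems n m T u x.
          schur_stable (cmat A + z \<cdot>\<^sub>m cmat (B * K)))"

definition network_mat ::
  "nat \<Rightarrow> real mat \<Rightarrow> real mat \<Rightarrow> real mat \<Rightarrow> real mat \<Rightarrow> real mat" where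
  "network_mat p C A B K = 1\<^sub>m p \<otimes>\<^sub>K A + C \<otimes>\<^sub>K (B * K)"

definition trajectory :: "real mat \<Rightarrow> (nat \<Rightarrow> real vec) \<Rightarrow> bool" where
  "trajectory M X \<longleftrightarrow> (\<forall>k. X k \<in> carrier_vec (dim_col M) \<and> X (Suc k) = M *\<^sub>v X k)"

text \<open>The \<open>i\<close>-th of the consecutive blocks of length \<open>n\<close>, with \<open>i\<close> counted from \<open>0\<close>.\<close>

definition block :: "nat \<Rightarrow> nat \<Rightarrow> real vec \<Rightarrow> real vec" where
  "block n i X = vec n (\<lambda>r. X $ (i * n + r))"

text \<open>Type \<open>vec\<close> carries no topology, so convergence to \<open>0\<close> in \<open>\<real>\<^sup>n\<close> is written componentwise.\<close>

definition synchronized :: "nat \<Rightarrow> nat \<Rightarrow> real mat \<Rightarrow> bool" where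
  "synchronized p n M \<longleftrightarrow>
     (\<forall>X. trajectory M X \<longrightarrow>
       (\<forall>i < p. \<forall>j < p. \<forall>r < n.
          (\<lambda>k. (block n i (X k) - block n j (X k)) $ r) \<longlonglongrightarrow> 0))"

definition sync_right_inverses ::
  "real mat \<Rightarrow> real mat \<Rightarrow> real mat \<Rightarrow> nat \<Rightarrow> (nat \<Rightarrow> real) \<Rightarrow> (nat \<Rightarrow> real mat) \<Rightarrow> bool" where
  "sync_right_inverses U Xm Xp l lam R \<longleftrightarrow>
     (\<forall>i \<in> {1..l}. right_inverse Xm (R i) \<and> schur_stable (cmat (Xp * R i))) \<and>
     (\<forall>i \<in> {1..l}. \<forall>j \<in> {1..l}.
        U * (lam i \<cdot>\<^sub>m R j - lam j \<cdot>\<^sub>m R i) = 0\<^sub>m (dim_row U) (dim_row Xm))"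

end

theory Submission
  imports Defs
begin

text \<open>
  Necessity: for \<open>\<lambda> = \<lambda>\<^sub>i\<close>, let \<open>R\<close> be a least squares solution of \<open>X R = I\<close>, \<open>U R = \<lambda>K\<close>
  with residuals \<open>A\<^sub>0\<^sup>T\<close> and \<open>B\<^sub>0\<^sup>T\<close>. The normal equations say \<open>A\<^sub>0 X + B\<^sub>0 U = 0\<close>, so
  \<open>(A + tA\<^sub>0, B + tB\<^sub>0)\<close> is consistent with the data for every real \<open>t\<close>. The trace of a Schur matrix
  is bounded by its size, hence \<open>A\<^sub>0 + \<lambda>B\<^sub>0K\<close> has trace \<open>0\<close>; but that trace is the squared norm of
  the residuals, so \<open>R\<close> solves both equations exactly.

  Sufficiency: condition (b) gives \<open>U R\<^sub>i = \<lambda>\<^sub>iK\<close>, whence \<open>X\<^sub>+ R\<^sub>i = A + \<lambda>\<^sub>iBK\<close>.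

  Synchronization: put \<open>\<mu>\<close> first in a triangularization \<open>C = P D P\<^sup>-\<^sup>1\<close>. In the transformed
  coordinates every block except the first obeys a stable recursion driven only by later blocks, so
  these blocks vanish from the last one upwards. As \<open>\<mu>\<close> is simple, the first column of \<open>P\<close> is a
  multiple of the all-ones vector, so the first block cancels in \<open>x\<^sub>i - x\<^sub>j\<close>.
\<close>

section \<open>Least squares and the normal equations\<close>

text \<open>Gram-Schmidt, one vector at a time: with \<open>r\<close> the part of \<open>w T\<close>
  orthogonal to the earlier \<open>w j\<close>, subtracting from the old residual of
  \<open>y\<close> its projection onto \<open>r\<close> keeps the old orthogonality relations and
  adds the one for \<open>w T\<close>. The \<open>w j\<close> may be linearly dependent.\<close>

lemma orthogonal_residual:
  fixes w :: "nat \<Rightarrow> 'i \<Rightarrow> real" and y :: "'i \<Rightarrow> real"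
  assumes "finite I"
  shows "\<exists>c. \<forall>j<T. (\<Sum>i\<in>I. w j i * (y i - (\<Sum>k<T. c k * w k i))) = 0"
proof (induction T arbitrary: y)
  case 0
  then show ?case by simp
next
  case (Suc T)
  obtain d where d: "(\<Sum>i\<in>I. w j i * (w T i - (\<Sum>k<T. d k * w k i))) = 0" if "j < T" for j
    using Suc[of "w T"] by blast
  obtain c where c: "(\<Sum>i\<in>I. w j i * (y i - (\<Sum>k<T. c k * w k i))) = 0" if "j < T" for j
    using Suc[of y] by blast
  define r where "r i = w T i - (\<Sum>k<T. d k * w k i)" for i
  define s where "s i = y i - (\<Sum>k<T. c k * w k i)" for i
  \<comment> \<open>Coefficient of the projection of \<open>s\<close> onto \<open>r\<close>. If
    \<open>r\<close> vanishes on \<open>I\<close>, division by zero makes it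
    \<open>0\<close>.\<close>
  define \<alpha> where "\<alpha> = (\<Sum>i\<in>I. r i * s i) / (\<Sum>i\<in>I. r i * r i)"
  \<comment> \<open>Collects the coefficients of \<open>w k\<close> in the combination whose
    residual is \<open>s - \<alpha> r\<close>.\<close>
  define e where "e k = (if k = T then \<alpha> else c k - \<alpha> * d k)" for k
  have res: "y i - (\<Sum>k<Suc T. e k * w k i) = s i - \<alpha> * r i" for i
  proof -
    have "(\<Sum>k<T. e k * w k i) = (\<Sum>k<T. c k * w k i) - \<alpha> * (\<Sum>k<T. d k * w k i)"
      unfolding sum_distrib_left sum_subtractf[symmetric]
      by (rule sum.cong) (auto simp: e_def algebra_simps)
    then show ?thesis
      by (simp add: s_def r_def e_def algebra_simps)
  qed
  have old: "(\<Sum>i\<in>I. w j i * (s i - \<alpha> * r i)) = 0" if "j < T" for j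
  proof -
    have "(\<Sum>i\<in>I. w j i * (s i - \<alpha> * r i)) = (\<Sum>i\<in>I. w j i * s i) - \<alpha> * (\<Sum>i\<in>I. w j i * r i)"
      by (simp add: sum_distrib_left sum_subtractf algebra_simps)
    then show ?thesis using c[OF that] d[OF that] by (simp add: s_def r_def)
  qed
  have new: "(\<Sum>i\<in>I. r i * (s i - \<alpha> * r i)) = 0"
  proof (cases "(\<Sum>i\<in>I. r i * r i) = 0")
    case True
    then have "\<forall>i\<in>I. r i * r i = 0"
      using assms by (subst (asm) sum_nonneg_eq_0_iff) auto
    then show ?thesis by simp
  next
    case False
    have "(\<Sum>i\<in>I. r i * (s i - \<alpha> * r i)) = (\<Sum>i\<in>I. r i * s i) - \<alpha> * (\<Sum>i\<in>I. r i * r i)"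
      by (simp add: sum_distrib_left sum_subtractf algebra_simps)
    then show ?thesis using False by (simp add: \<alpha>_def)
  qed
  \<comment> \<open>\<open>w T\<close> is \<open>r\<close> plus a combination of the earlier
    vectors, to all of which the new residual is orthogonal.\<close>
  have "(\<Sum>i\<in>I. w T i * (s i - \<alpha> * r i)) =
      (\<Sum>i\<in>I. r i * (s i - \<alpha> * r i)) + (\<Sum>k<T. d k * (\<Sum>i\<in>I. w k i * (s i - \<alpha> * r i)))"
  proof -
    have "(\<Sum>k<T. d k * (\<Sum>i\<in>I. w k i * (s i - \<alpha> * r i))) =
        (\<Sum>i\<in>I. (\<Sum>k<T. d k * w k i) * (s i - \<alpha> * r i))"
      unfolding sum_distrib_left sum_distrib_right
      by (subst sum.swap) (simp add: mult.assoc)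
    then show ?thesis
      by (simp add: r_def sum.distrib[symmetric] algebra_simps)
  qed
  also have "\<dots> = 0" using new old by simp
  finally have "(\<Sum>i\<in>I. w T i * (s i - \<alpha> * r i)) = 0" .
  with old have "\<forall>j<Suc T. (\<Sum>i\<in>I. w j i * (y i - (\<Sum>k<Suc T. e k * w k i))) = 0"
    unfolding res by (auto simp: less_Suc_eq)
  then show ?case by blast
qed

text \<open>\<open>X\<close> is stacked over \<open>U\<close>, and \<open>Y\<close> over
  \<open>V\<close>, with a sum type as row index; column \<open>b\<close> of \<open>R\<close> then
  holds the least squares coefficients for column \<open>b\<close> of the stacked right-hand side.
  Entry \<open>(b, j)\<close> of the identity is the orthogonality of residual \<open>b\<close> to
  stacked column \<open>j\<close>.\<close>

lemma normal_equations:
  fixes X U Y V :: "real mat"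
  assumes X: "X \<in> carrier_mat n T" and U: "U \<in> carrier_mat m T"
    and Y: "Y \<in> carrier_mat n q" and V: "V \<in> carrier_mat m q"
  shows "\<exists>R \<in> carrier_mat T q.
    (Y - X * R)\<^sup>T * X + (V - U * R)\<^sup>T * U = 0\<^sub>m q T"
proof -
  define w where "w j i = (case i of Inl a \<Rightarrow> X $$ (a, j) | Inr a \<Rightarrow> U $$ (a, j))" for j i
  define y where "y b i = (case i of Inl a \<Rightarrow> Y $$ (a, b) | Inr a \<Rightarrow> V $$ (a, b))" for b i
  have "\<forall>b. \<exists>c. \<forall>j<T. (\<Sum>i\<in>{..<n} <+> {..<m}. w j i * (y b i - (\<Sum>k<T. c k * w k i))) = 0"
    by (intro allI orthogonal_residual) auto
  from choice[OF this] obtain c where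
    c: "\<forall>b. \<forall>j<T. (\<Sum>i\<in>{..<n} <+> {..<m}. w j i * (y b i - (\<Sum>k<T. c b k * w k i))) = 0" ..
  define R where "R = mat T q (\<lambda>(k, b). c b k)"
  have R: "R \<in> carrier_mat T q" by (simp add: R_def)
  have "(Y - X * R)\<^sup>T * X + (V - U * R)\<^sup>T * U = 0\<^sub>m q T"
  proof (rule eq_matI)
    fix b j assume "b < dim_row (0\<^sub>m q T :: real mat)" "j < dim_col (0\<^sub>m q T :: real mat)"
    then have bj: "b < q" "j < T" by auto
    show "((Y - X * R)\<^sup>T * X + (V - U * R)\<^sup>T * U) $$ (b, j) = 0\<^sub>m q T $$ (b, j)"
    proof -
      have "((Y - X * R)\<^sup>T * X) $$ (b, j) =
          (\<Sum>i<n. X $$ (i, j) * (Y $$ (i, b) - (\<Sum>k<T. c b k * X $$ (i, k))))"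
        using bj X Y by (simp add: scalar_prod_def R_def atLeast0LessThan mult.commute)
      moreover have "((V - U * R)\<^sup>T * U) $$ (b, j) =
          (\<Sum>i<m. U $$ (i, j) * (V $$ (i, b) - (\<Sum>k<T. c b k * U $$ (i, k))))"
        using bj U V by (simp add: scalar_prod_def R_def atLeast0LessThan mult.commute)
      moreover have "((Y - X * R)\<^sup>T * X + (V - U * R)\<^sup>T * U) $$ (b, j) =
          ((Y - X * R)\<^sup>T * X) $$ (b, j) + ((V - U * R)\<^sup>T * U) $$ (b, j)"
        using bj U X V R by (intro index_add_mat) auto
      ultimately show ?thesis
        using c[rule_format, OF bj(2), of b] bj by (simp add: sum.Plus w_def y_def comp_def)
    qed
  qed (use X U Y V R in auto)
  with R show ?thesis by blast
qed

section \<open>Trace and triangular form of Schur matrices\<close>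

definition mat_trace :: "'a :: comm_semiring_0 mat \<Rightarrow> 'a" where
  "mat_trace A = (\<Sum>i<dim_row A. A $$ (i, i))"

lemma mat_trace_comm:
  assumes "A \<in> carrier_mat n m" "B \<in> carrier_mat m n"
  shows "mat_trace (A * B) = mat_trace (B * A)"
proof -
  have "mat_trace (A * B) = (\<Sum>i<n. \<Sum>k<m. A $$ (i, k) * B $$ (k, i))"
    using assms by (simp add: mat_trace_def scalar_prod_def atLeast0LessThan)
  also have "\<dots> = (\<Sum>k<m. \<Sum>i<n. B $$ (k, i) * A $$ (i, k))"
    by (subst sum.swap) (simp add: mult.commute)
  also have "\<dots> = mat_trace (B * A)"
    using assms by (simp add: mat_trace_def scalar_prod_def atLeast0LessThan)
  finally show ?thesis .
qed

text \<open>The list \<open>es\<close> prescribes the order of the eigenvalues on the diagonal,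
  which later allows \<open>\<mu>\<close> to be put first.\<close>

lemma triangularize:
  fixes A :: "complex mat"
  assumes A: "A \<in> carrier_mat n n" and es: "char_poly A = (\<Prod>e\<leftarrow>es. [:- e, 1:])"
  obtains B P Q where "similar_mat_wit A B P Q" "upper_triangular B" "diag_mat B = es"
  using schur_decomposition[OF A es] by (metis prod_cases3)

lemma schur_stable_triangularize:
  assumes M: "M \<in> carrier_mat n n" and "schur_stable M"
  shows "\<exists>B P Q. similar_mat_wit M B P Q \<and> upper_triangular B \<and> (\<forall>i<n. cmod (B $$ (i, i)) < 1)"
proof -
  obtain es where es: "char_poly M = (\<Prod>e\<leftarrow>es. [:- e, 1:])"
    using char_poly_factorized[OF M] by blast
  obtain B P Q where B: "similar_mat_wit M B P Q" "upper_triangular B" "diag_mat B = es"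
    using triangularize[OF M es] .
  have Bc: "B \<in> carrier_mat n n" using similar_mat_witD2[OF M B(1)] by blast
  have "cmod (B $$ (i, i)) < 1" if "i < n" for i
  proof -
    have "B $$ (i, i) \<in> set es" using that Bc by (auto simp: B(3)[symmetric] diag_mat_def)
    then have "poly (char_poly M) (B $$ (i, i)) = 0"
      unfolding es poly_prod_list by (auto simp: prod_list_zero_iff)
    then have "B $$ (i, i) \<in> spectrum M"
      using spectrum_root_char_poly[OF M] by auto
    then show ?thesis using assms(2) by (auto simp: schur_stable_def)
  qed
  with B show ?thesis by blast
qed

text \<open>The trace is invariant under similarity, hence a sum of \<open>n\<close> diagonal
  entries of modulus less than 1.\<close>

lemma cmod_mat_trace_le:
  assumes M: "M \<in> carrier_mat n n" and "schur_stable M"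
  shows "cmod (mat_trace M) \<le> n"
proof -
  obtain B P Q where B: "similar_mat_wit M B P Q" and "upper_triangular B" and
    d: "\<forall>i<n. cmod (B $$ (i, i)) < 1"
    using schur_stable_triangularize[OF assms] by blast
  note w = similar_mat_witD2[OF M B]
  have "mat_trace M = mat_trace (P * (B * Q))" 
    unfolding w(3) using w(5-7) by (simp add: assoc_mult_mat[of P n n B n Q n])
  also have "\<dots> = mat_trace (B * (Q * P))" 
    using w(5-7) mat_trace_comm[of P n n "B * Q"] by (simp add: assoc_mult_mat[of B n n Q n P n])
  also have "\<dots> = mat_trace B" using w(2,5) by simp
  finally have "cmod (mat_trace M) \<le> (\<Sum>i<n. cmod (B $$ (i, i)))"
    using w(5) by (simp add: mat_trace_def norm_sum)
  also have "\<dots> \<le> (\<Sum>i<n. 1)" by (rule sum_mono) (use d less_imp_le in auto)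
  finally show ?thesis by simp
qed

section \<open>Convergence of stable linear recursions\<close>

text \<open>Once the forcing is below \<open>d\<close>, each step multiplies the modulus by at most
  \<open>r\<close> and adds at most \<open>d\<close>; the initial value is forgotten
  geometrically.\<close>

lemma affine_recursion_tendsto_0:
  fixes z v :: "nat \<Rightarrow> complex"
  assumes rec: "\<And>k. z (Suc k) = a * z k + v k" and a: "cmod a < 1" and v: "v \<longlonglongrightarrow> 0"
  shows "z \<longlonglongrightarrow> 0"
proof (rule LIMSEQ_I)
  fix e :: real assume e: "e > 0"
  define r where "r = cmod a"
  have r: "0 \<le> r" "r < 1" using a by (auto simp: r_def)
  \<comment> \<open>Makes \<open>e / 2\<close> the fixed point of the map sending \<open>t\<close>
    to \<open>r * t + d\<close>.\<close>
  define d where "d = e / 2 * (1 - r)"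
  have "d > 0" using e r by (simp add: d_def)
  then obtain N where N: "\<And>k. k \<ge> N \<Longrightarrow> cmod (v k) < d"
    using LIMSEQ_D[OF v] by fastforce
  have bound: "cmod (z (N + k)) \<le> r ^ k * cmod (z N) + e / 2" for k
  proof (induction k)
    case 0
    then show ?case using e by simp
  next
    case (Suc k)
    have "cmod (z (N + Suc k)) \<le> r * cmod (z (N + k)) + cmod (v (N + k))"
      unfolding r_def norm_mult[symmetric] by (simp add: rec norm_triangle_ineq)
    also have "\<dots> \<le> r * (r ^ k * cmod (z N) + e / 2) + d"
      using Suc N[of "N + k"] r by (intro add_mono mult_left_mono) auto
    also have "\<dots> = r ^ Suc k * cmod (z N) + e / 2"
      by (simp add: d_def field_simps)
    finally show ?case .
  qed
  have "(\<lambda>k. r ^ k * cmod (z N)) \<longlonglongrightarrow> 0"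
    using r by (intro tendsto_mult_left_zero LIMSEQ_realpow_zero) 
  then obtain L where L: "\<And>k. k \<ge> L \<Longrightarrow> r ^ k * cmod (z N) < e / 2"
    using LIMSEQ_D[of "\<lambda>k. r ^ k * cmod (z N)" 0 "e / 2"] e r by fastforce
  show "\<exists>no. \<forall>k\<ge>no. cmod (z k - 0) < e"
  proof (intro exI allI impI)
    fix k assume k: "N + L \<le> k"
    then have "r ^ (k - N) * cmod (z N) < e / 2" by (intro L) simp
    then show "cmod (z k - 0) < e"
      using bound[of "k - N"] k by simp
  qed
qed

lemma index_mult_mat_sum:
  assumes "A \<in> carrier_mat n m" "B \<in> carrier_mat m q" "i < n" "j < q"
  shows "(A * B) $$ (i, j) = (\<Sum>k<m. A $$ (i, k) * B $$ (k, j))"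
  using assms by (simp add: scalar_prod_def atLeast0LessThan)

text \<open>Serves back substitution: row \<open>i\<close> of an upper triangular system involves,
  besides unknown \<open>i\<close>, only later unknowns.\<close>

lemma downward_induct [consumes 1, case_names step]:
  fixes i n :: nat
  assumes "i < n" and step: "\<And>i. i < n \<Longrightarrow> (\<And>j. i < j \<Longrightarrow> j < n \<Longrightarrow> P j) \<Longrightarrow> P i"
  shows "P i"
  using assms(1)
proof (induction "n - i" arbitrary: i rule: less_induct)
  case less
  show ?case by (rule step) (use less in auto)
qed

lemma upper_triangular_row_sum:
  fixes B :: "'a :: comm_ring_1 mat"
  assumes "B \<in> carrier_mat n n" "upper_triangular B" "i < n"
  shows "(\<Sum>j<n. B $$ (i, j) * f j) = B $$ (i, i) * f i + (\<Sum>j\<in>{i<..<n}. B $$ (i, j) * f j)"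
proof -
  have "{..<n} = {..<i} \<union> insert i {i<..<n}" using assms(3) by auto
  moreover have "(\<Sum>j\<in>{..<i} \<union> insert i {i<..<n}. B $$ (i, j) * f j) =
      (\<Sum>j<i. B $$ (i, j) * f j) + (\<Sum>j\<in>insert i {i<..<n}. B $$ (i, j) * f j)"
    by (rule sum.union_disjoint) auto
  moreover have "(\<Sum>j<i. B $$ (i, j) * f j) = 0"
    using assms by (intro sum.neutral) (auto simp: upper_triangularD)
  ultimately show ?thesis by simp
qed

text \<open>Row \<open>i\<close> of \<open>Q (C f) = B (Q f)\<close>. Vectors are functions here, so
  that \<open>f\<close> can be one state component taken across all agents.\<close>

lemma intertwining_sum:
  fixes Q C B :: "'a :: comm_ring_1 mat"
  assumes Q: "Q \<in> carrier_mat n n" and C: "C \<in> carrier_mat n n" and B: "B \<in> carrier_mat n n"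
    and QC: "Q * C = B * Q" and i: "i < n"
  shows "(\<Sum>a<n. Q $$ (i, a) * (\<Sum>b<n. C $$ (a, b) * f b)) =
    (\<Sum>j<n. B $$ (i, j) * (\<Sum>b<n. Q $$ (j, b) * f b))"
proof -
  have "(\<Sum>a<n. Q $$ (i, a) * (\<Sum>b<n. C $$ (a, b) * f b)) =
      (\<Sum>b<n. (\<Sum>a<n. Q $$ (i, a) * C $$ (a, b)) * f b)"
    unfolding sum_distrib_left sum_distrib_right by (subst sum.swap) (simp add: mult.assoc)
  also have "\<dots> = (\<Sum>b<n. (\<Sum>j<n. B $$ (i, j) * Q $$ (j, b)) * f b)"
  proof (rule sum.cong)
    fix b assume "b \<in> {..<n}"
    then have "(\<Sum>a<n. Q $$ (i, a) * C $$ (a, b)) = (\<Sum>j<n. B $$ (i, j) * Q $$ (j, b))"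
      using QC index_mult_mat_sum[OF Q C i, of b] index_mult_mat_sum[OF B Q i, of b] by simp
    then show "(\<Sum>a<n. Q $$ (i, a) * C $$ (a, b)) * f b = (\<Sum>j<n. B $$ (i, j) * Q $$ (j, b)) * f b"
      by simp
  qed simp
  also have "\<dots> = (\<Sum>j<n. B $$ (i, j) * (\<Sum>b<n. Q $$ (j, b) * f b))"
    unfolding sum_distrib_left sum_distrib_right by (subst sum.swap) (simp add: mult.assoc)
  finally show ?thesis .
qed

text \<open>Row \<open>a\<close> of \<open>P (Q f) = f\<close>, which leads back from the
  transformed coordinates.\<close>

lemma inverse_pair_sum:
  fixes P Q :: "'a :: comm_ring_1 mat"
  assumes P: "P \<in> carrier_mat n n" and Q: "Q \<in> carrier_mat n n" and PQ: "P * Q = 1\<^sub>m n"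
    and a: "a < n"
  shows "(\<Sum>i<n. P $$ (a, i) * (\<Sum>b<n. Q $$ (i, b) * f b)) = f a"
proof -
  have "(\<Sum>i<n. P $$ (a, i) * (\<Sum>b<n. Q $$ (i, b) * f b)) =
      (\<Sum>b<n. (\<Sum>i<n. P $$ (a, i) * Q $$ (i, b)) * f b)"
    unfolding sum_distrib_left sum_distrib_right by (subst sum.swap) (simp add: mult.assoc)
  also have "\<dots> = (\<Sum>b<n. if a = b then f b else 0)"
  proof (rule sum.cong)
    fix b assume "b \<in> {..<n}"
    then show "(\<Sum>i<n. P $$ (a, i) * Q $$ (i, b)) * f b = (if a = b then f b else 0)"
      using PQ a index_mult_mat_sum[OF P Q a, of b] by (simp flip: index_mult_mat_sum[OF P Q a])
  qed simp
  also have "\<dots> = f a" using a by simp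
  finally show ?thesis .
qed

lemma similar_mat_wit_intertwines:
  assumes M: "M \<in> carrier_mat n n" and "similar_mat_wit M B P Q"
  shows "Q * M = B * Q"
proof -
  note w = similar_mat_witD2[OF assms]
  have "Q * M = Q * (P * (B * Q))"
    unfolding w(3) using w(5-7) by (simp add: assoc_mult_mat[of P n n B n Q n])
  also have "\<dots> = (Q * P) * (B * Q)"
    using w(5-7) by (simp add: assoc_mult_mat[of Q n n P n "B * Q" n])
  also have "\<dots> = B * Q" using w(2,5,7) by simp
  finally show ?thesis .
qed

text \<open>In the coordinates \<open>Q z\<close> the matrix becomes triangular: component
  \<open>i\<close> obeys a scalar recursion whose factor \<open>B $$ (i, i)\<close> has modulus less
  than 1, driven by later components and by the transformed forcing. Both vanish in the limit, by
  descending induction.\<close>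

lemma schur_stable_recursion_tendsto_0:
  fixes z v :: "nat \<Rightarrow> nat \<Rightarrow> complex"
  assumes M: "M \<in> carrier_mat n n" and stable: "schur_stable M"
    and rec: "\<And>k r. r < n \<Longrightarrow> z (Suc k) r = (\<Sum>s<n. M $$ (r, s) * z k s) + v k r"
    and v: "\<And>r. r < n \<Longrightarrow> (\<lambda>k. v k r) \<longlonglongrightarrow> 0"
    and r: "r < n"
  shows "(\<lambda>k. z k r) \<longlonglongrightarrow> 0"
proof -
  obtain B P Q where B: "similar_mat_wit M B P Q" and ut: "upper_triangular B" and
    d: "\<forall>i<n. cmod (B $$ (i, i)) < 1"
    using schur_stable_triangularize[OF M stable] by blast
  note w = similar_mat_witD2[OF M B]
  define y where "y k i = (\<Sum>r<n. Q $$ (i, r) * z k r)" for k i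
  have y_rec: "y (Suc k) i = B $$ (i, i) * y k i +
      ((\<Sum>j\<in>{i<..<n}. B $$ (i, j) * y k j) + (\<Sum>r<n. Q $$ (i, r) * v k r))" if i: "i < n" for k i
  proof -
    have "y (Suc k) i = (\<Sum>r<n. Q $$ (i, r) * ((\<Sum>s<n. M $$ (r, s) * z k s) + v k r))"
      unfolding y_def by (rule sum.cong) (auto simp: rec)
    also have "\<dots> = (\<Sum>r<n. Q $$ (i, r) * (\<Sum>s<n. M $$ (r, s) * z k s)) + (\<Sum>r<n. Q $$ (i, r) * v k r)"
      by (simp add: distrib_left sum.distrib)
    also have "(\<Sum>r<n. Q $$ (i, r) * (\<Sum>s<n. M $$ (r, s) * z k s)) = (\<Sum>j<n. B $$ (i, j) * y k j)"
      unfolding y_def by (rule intertwining_sum[OF w(7) M w(5) similar_mat_wit_intertwines[OF M B] i])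
    also have "\<dots> = B $$ (i, i) * y k i + (\<Sum>j\<in>{i<..<n}. B $$ (i, j) * y k j)"
      by (rule upper_triangular_row_sum[OF w(5) ut i])
    finally show ?thesis by simp
  qed
  have y: "(\<lambda>k. y k i) \<longlonglongrightarrow> 0" if "i < n" for i
    using that
  proof (induction rule: downward_induct)
    case (step i)
    have "(\<lambda>k. (\<Sum>j\<in>{i<..<n}. B $$ (i, j) * y k j) + (\<Sum>r<n. Q $$ (i, r) * v k r)) \<longlonglongrightarrow> 0"
      using step.IH v by (intro tendsto_add_zero tendsto_null_sum tendsto_mult_right_zero) auto
    with y_rec[OF step.hyps] d step.hyps show ?case
      by (intro affine_recursion_tendsto_0[where z = "\<lambda>k. y k i"]) auto
  qed
  have "(\<lambda>k. \<Sum>i<n. P $$ (r, i) * y k i) \<longlonglongrightarrow> 0"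
    using y by (intro tendsto_null_sum tendsto_mult_right_zero) auto
  moreover have "(\<Sum>i<n. P $$ (r, i) * y k i) = z k r" for k
    unfolding y_def by (rule inverse_pair_sum[OF w(6,7,1) r])
  ultimately show ?thesis by simp
qed

section \<open>Synchronization of coupled agents\<close>

text \<open>\<open>\<xi> k a r\<close> is component \<open>r\<close> of agent \<open>a\<close> at
  time \<open>k\<close>, and \<open>G\<close> stands for \<open>BK\<close>. The change of
  coordinates acts on the agent index alone; it turns coupling by \<open>C\<close> into coupling by
  the triangular \<open>B\<close>, so block \<open>i\<close> evolves under
  \<open>A + B $$ (i, i) \<cdot>\<^sub>m G\<close> and is driven by later blocks.\<close>

lemma coupled_recursion_synchronizes:
  fixes A G C :: "complex mat" and \<xi> :: "nat \<Rightarrow> nat \<Rightarrow> nat \<Rightarrow> complex"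
  assumes A: "A \<in> carrier_mat n n" and G: "G \<in> carrier_mat n n" and C: "C \<in> carrier_mat p p"
    and B: "similar_mat_wit C B P Q" and ut: "upper_triangular B"
    and row_sum: "\<And>a. a < p \<Longrightarrow> (\<Sum>b<p. C $$ (a, b)) = \<mu>"
    and simple: "\<And>i. 0 < i \<Longrightarrow> i < p \<Longrightarrow> B $$ (i, i) \<noteq> \<mu>"
    and stable: "\<And>i. 0 < i \<Longrightarrow> i < p \<Longrightarrow> schur_stable (A + B $$ (i, i) \<cdot>\<^sub>m G)"
    and rec: "\<And>k a r. a < p \<Longrightarrow> r < n \<Longrightarrow> \<xi> (Suc k) a r =
      (\<Sum>s<n. A $$ (r, s) * \<xi> k a s) + (\<Sum>b<p. C $$ (a, b) * (\<Sum>s<n. G $$ (r, s) * \<xi> k b s))"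
    and a: "a < p" and b: "b < p" and r: "r < n"
  shows "(\<lambda>k. \<xi> k a r - \<xi> k b r) \<longlonglongrightarrow> 0"
proof -
  note w = similar_mat_witD2[OF C B]
  note QC = similar_mat_wit_intertwines[OF C B]
  define y where "y k i r = (\<Sum>a<p. Q $$ (i, a) * \<xi> k a r)" for k i r
  \<comment> \<open>\<open>Q\<close> mixes agents and \<open>N\<close> mixes state components, so
    the two commute.\<close>
  have push: "(\<Sum>a<p. Q $$ (i, a) * (\<Sum>s<n. N $$ (r, s) * \<xi> k a s)) = (\<Sum>s<n. N $$ (r, s) * y k i s)"
    for N :: "complex mat" and k i r
    unfolding y_def sum_distrib_left by (subst sum.swap) (simp add: mult.left_commute)
  have y_rec: "y (Suc k) i r = (\<Sum>s<n. (A + B $$ (i, i) \<cdot>\<^sub>m G) $$ (r, s) * y k i s) +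
      (\<Sum>j\<in>{i<..<p}. B $$ (i, j) * (\<Sum>s<n. G $$ (r, s) * y k j s))"
    if i: "i < p" and r: "r < n" for k i r
  proof -
    have "y (Suc k) i r = (\<Sum>a<p. Q $$ (i, a) *
        ((\<Sum>s<n. A $$ (r, s) * \<xi> k a s) + (\<Sum>b<p. C $$ (a, b) * (\<Sum>s<n. G $$ (r, s) * \<xi> k b s))))"
      unfolding y_def by (rule sum.cong) (auto simp: rec r)
    also have "\<dots> = (\<Sum>s<n. A $$ (r, s) * y k i s) +
        (\<Sum>a<p. Q $$ (i, a) * (\<Sum>b<p. C $$ (a, b) * (\<Sum>s<n. G $$ (r, s) * \<xi> k b s)))"
      unfolding distrib_left sum.distrib push ..
    also have "(\<Sum>a<p. Q $$ (i, a) * (\<Sum>b<p. C $$ (a, b) * (\<Sum>s<n. G $$ (r, s) * \<xi> k b s))) =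
        (\<Sum>j<p. B $$ (i, j) * (\<Sum>s<n. G $$ (r, s) * y k j s))"
      unfolding intertwining_sum[OF w(7) C w(5) QC i] push ..
    also have "\<dots> = B $$ (i, i) * (\<Sum>s<n. G $$ (r, s) * y k i s) +
        (\<Sum>j\<in>{i<..<p}. B $$ (i, j) * (\<Sum>s<n. G $$ (r, s) * y k j s))"
      by (rule upper_triangular_row_sum[OF w(5) ut i])
    also have "(\<Sum>s<n. A $$ (r, s) * y k i s) + (B $$ (i, i) * (\<Sum>s<n. G $$ (r, s) * y k i s) +
        (\<Sum>j\<in>{i<..<p}. B $$ (i, j) * (\<Sum>s<n. G $$ (r, s) * y k j s))) =
        (\<Sum>s<n. (A + B $$ (i, i) \<cdot>\<^sub>m G) $$ (r, s) * y k i s) +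
        (\<Sum>j\<in>{i<..<p}. B $$ (i, j) * (\<Sum>s<n. G $$ (r, s) * y k j s))"
      unfolding add.assoc[symmetric] sum_distrib_left[of "B $$ (i, i)"] sum.distrib[symmetric]
      using A G r by (intro arg_cong2[where f = plus] sum.cong refl) (simp add: algebra_simps)
    finally show ?thesis .
  qed
  have y: "\<forall>r<n. (\<lambda>k. y k i r) \<longlonglongrightarrow> 0" if "i < p" "0 < i" for i
    using that
  proof (induction rule: downward_induct)
    case (step i)
    \<comment> \<open>Only blocks after \<open>i\<close> enter the forcing, and these vanish by the
      induction hypothesis.\<close>
    have v: "(\<lambda>k. \<Sum>j\<in>{i<..<p}. B $$ (i, j) * (\<Sum>s<n. G $$ (r, s) * y k j s)) \<longlonglongrightarrow> 0" for r
      using step by (intro tendsto_null_sum tendsto_mult_right_zero) auto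
    have "(\<lambda>k. y k i r) \<longlonglongrightarrow> 0" if "r < n" for r
    proof (rule schur_stable_recursion_tendsto_0[where z = "\<lambda>k. y k i" and
        v = "\<lambda>k r. \<Sum>j\<in>{i<..<p}. B $$ (i, j) * (\<Sum>s<n. G $$ (r, s) * y k j s)"])
      show "schur_stable (A + B $$ (i, i) \<cdot>\<^sub>m G)" using stable step by blast
      show "A + B $$ (i, i) \<cdot>\<^sub>m G \<in> carrier_mat n n" using A G by auto
    qed (use y_rec[OF step.hyps] v that in auto)
    then show ?case by blast
  qed
  \<comment> \<open>The all-ones vector in the new coordinates; the factor \<open>1\<close> matches
    the shape of \<open>intertwining_sum\<close> and \<open>inverse_pair_sum\<close>.\<close>
  define h where "h i = (\<Sum>a<p. Q $$ (i, a) * 1)" for i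
  \<comment> \<open>Constant row sums make the all-ones vector an eigenvector of \<open>C\<close>,
    so \<open>h\<close> satisfies \<open>B h = \<mu> h\<close>.\<close>
  have h_eig: "\<mu> * h i = B $$ (i, i) * h i + (\<Sum>j\<in>{i<..<p}. B $$ (i, j) * h j)" if i: "i < p" for i
  proof -
    have "\<mu> * h i = (\<Sum>a<p. Q $$ (i, a) * (\<Sum>b<p. C $$ (a, b) * 1))"
      unfolding h_def sum_distrib_left[of \<mu>] using row_sum by (intro sum.cong) (auto simp: mult.commute)
    also have "\<dots> = (\<Sum>j<p. B $$ (i, j) * h j)"
      unfolding h_def by (rule intertwining_sum[OF w(7) C w(5) QC i])
    also have "\<dots> = B $$ (i, i) * h i + (\<Sum>j\<in>{i<..<p}. B $$ (i, j) * h j)"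
      by (rule upper_triangular_row_sum[OF w(5) ut i])
    finally show ?thesis .
  qed
  \<comment> \<open>Once the later entries are zero, \<open>(\<mu> - B $$ (i, i)) * h i = 0\<close>,
    and the first factor is nonzero.\<close>
  have h0: "h i = 0" if "i < p" "0 < i" for i
    using that
  proof (induction rule: downward_induct)
    case (step i)
    then have "(\<Sum>j\<in>{i<..<p}. B $$ (i, j) * h j) = 0" by (intro sum.neutral) auto
    with h_eig[OF step.hyps] simple[OF step.prems step.hyps] show ?case by simp
  qed
  have head: "(\<Sum>i<p. f i) = f 0 + (\<Sum>i\<in>{0<..<p}. f i)" for f :: "nat \<Rightarrow> complex"
  proof -
    have "{..<p} = insert 0 {0<..<p}" using a by auto
    then show ?thesis by simp
  qed
  \<comment> \<open>\<open>P h\<close> is the all-ones vector and only \<open>h 0\<close> survives,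
    so the first column of \<open>P\<close> is constant.\<close>
  have P0: "P $$ (a, 0) * h 0 = 1" if "a < p" for a
  proof -
    have "(\<Sum>i<p. P $$ (a, i) * h i) = 1"
      unfolding h_def by (rule inverse_pair_sum[OF w(6,7,1) that])
    then show ?thesis unfolding head using h0 by simp
  qed
  have P0_const: "P $$ (a, 0) = P $$ (b, 0)"
    using P0[OF a] P0[OF b] by (metis mult_right_cancel mult_zero_right zero_neq_one)
  have recon: "(\<Sum>i<p. P $$ (a, i) * y k i r) = \<xi> k a r" if "a < p" for k a
    unfolding y_def by (rule inverse_pair_sum[OF w(6,7,1) that])
  \<comment> \<open>Block \<open>0\<close>, which need not converge, has the same coefficient in
    both agents and cancels.\<close>
  have "\<xi> k a r - \<xi> k b r = (\<Sum>i\<in>{0<..<p}. (P $$ (a, i) - P $$ (b, i)) * y k i r)" for k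
    unfolding recon[OF a, symmetric] recon[OF b, symmetric] head
    by (simp add: P0_const left_diff_distrib sum_subtractf)
  moreover have "(\<lambda>k. \<Sum>i\<in>{0<..<p}. (P $$ (a, i) - P $$ (b, i)) * y k i r) \<longlonglongrightarrow> 0"
    using y r by (intro tendsto_null_sum tendsto_mult_right_zero) auto
  ultimately show ?thesis by simp
qed

section \<open>Row rank, and exact solvability from the trace bound\<close>

text \<open>Every \<open>v\<close> equals \<open>X (R v)\<close>, so the column space is the whole
  space.\<close>

lemma full_row_rank_of_right_inverse:
  assumes X: "X \<in> carrier_mat n T" and R: "R \<in> carrier_mat T n" and XR: "X * R = 1\<^sub>m n"
  shows "full_row_rank X"
proof -
  interpret vec_space "TYPE(real)" n .
  have "v \<in> col_space X" if "v \<in> carrier_vec n" for v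
  proof -
    have "X *\<^sub>v (R *\<^sub>v v) = v"
      using X R XR that by (metis assoc_mult_mat_vec one_mult_mat_vec)
    moreover have "R *\<^sub>v v \<in> carrier_vec T" using R that by simp
    ultimately show ?thesis unfolding col_space_eq[OF X] using X that by auto
  qed
  then have "span (set (cols X)) = carrier_vec n"
    using col_space_eq[OF X] X unfolding col_space_def by auto
  then have "rank X = n"
    unfolding rank_def using dim_is_n by (simp add: module_vec_def)
  then show ?thesis using X by (simp add: full_row_rank_def)
qed

lemma mat_trace_self_transpose:
  fixes A :: "real mat"
  assumes "A \<in> carrier_mat n m"
  shows "mat_trace (A * A\<^sup>T) = (\<Sum>i<n. \<Sum>j<m. (A $$ (i, j))\<^sup>2)"
  using assms by (simp add: mat_trace_def scalar_prod_def atLeast0LessThan power2_eq_square)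

lemma mat_trace_self_transpose_eq_0:
  fixes A :: "real mat"
  assumes A: "A \<in> carrier_mat n m" and "mat_trace (A * A\<^sup>T) \<le> 0"
  shows "A = 0\<^sub>m n m"
proof (rule eq_matI)
  fix i j assume ij: "i < dim_row (0\<^sub>m n m :: real mat)" "j < dim_col (0\<^sub>m n m :: real mat)"
  have "(A $$ (i, j))\<^sup>2 \<le> (\<Sum>j<m. (A $$ (i, j))\<^sup>2)"
    using ij by (intro member_le_sum) auto
  also have "\<dots> \<le> (\<Sum>i<n. \<Sum>j<m. (A $$ (i, j))\<^sup>2)"
    using ij by (intro member_le_sum[where f = "\<lambda>i. \<Sum>j<m. (A $$ (i, j))\<^sup>2"] sum_nonneg) auto
  also have "\<dots> \<le> 0"
    using assms(2) by (simp only: mat_trace_self_transpose[OF A])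
  finally show "A $$ (i, j) = 0\<^sub>m n m $$ (i, j)"
    using ij by simp
qed (use A in auto)

lemma mat_trace_add:
  "A \<in> carrier_mat n n \<Longrightarrow> B \<in> carrier_mat n n \<Longrightarrow> mat_trace (A + B) = mat_trace A + mat_trace B"
  by (simp add: mat_trace_def sum.distrib)

lemma mat_trace_smult: "A \<in> carrier_mat n n \<Longrightarrow> mat_trace (c \<cdot>\<^sub>m A) = c * mat_trace A"
  by (simp add: mat_trace_def sum_distrib_left)

lemma mat_trace_cmat: "A \<in> carrier_mat n n \<Longrightarrow> mat_trace (cmat A) = complex_of_real (mat_trace A)"
  by (simp add: mat_trace_def)

text \<open>The trace of \<open>M + t N\<close> is affine in \<open>t\<close> and bounded by
  \<open>n\<close> for all real \<open>t\<close>, so its slope is zero.\<close>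

lemma mat_trace_direction_eq_0:
  assumes M: "M \<in> carrier_mat n n" and N: "N \<in> carrier_mat n n"
    and stable: "\<And>t. schur_stable (cmat (M + t \<cdot>\<^sub>m N))"
  shows "mat_trace N = 0"
proof (rule ccontr)
  assume nz: "mat_trace N \<noteq> 0"
  have bound: "\<bar>mat_trace M + t * mat_trace N\<bar> \<le> n" for t
  proof -
    have "cmod (mat_trace (cmat (M + t \<cdot>\<^sub>m N))) \<le> n"
      using M N stable by (intro cmod_mat_trace_le) auto
    also have "mat_trace (cmat (M + t \<cdot>\<^sub>m N)) = complex_of_real (mat_trace M + t * mat_trace N)"
      using M N by (simp add: mat_trace_cmat[of _ n] mat_trace_add[of _ n] mat_trace_smult[of _ n])
    finally show ?thesis by (simp only: norm_of_real)
  qed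
  show False
    \<comment> \<open>For this \<open>t\<close> the trace equals \<open>n + 1\<close>.\<close>
    using bound[of "(real n + 1 - mat_trace M) / mat_trace N"] nz by simp
qed

text \<open>\<open>L\<close> will be \<open>\<lambda>K\<close> for one eigenvalue. The pairs
  \<open>(A0, B0)\<close> are the directions in which a system can move without leaving the set of
  data-consistent systems.\<close>

lemma right_inverse_of_stable_family:
  fixes A B L X U :: "real mat"
  assumes A: "A \<in> carrier_mat n n" and B: "B \<in> carrier_mat n m" and L: "L \<in> carrier_mat m n"
    and X: "X \<in> carrier_mat n T" and U: "U \<in> carrier_mat m T"
    and stable: "\<And>A0 B0. A0 \<in> carrier_mat n n \<Longrightarrow> B0 \<in> carrier_mat n m \<Longrightarrow>
      A0 * X + B0 * U = 0\<^sub>m n T \<Longrightarrow> schur_stable (cmat ((A + A0) + (B + B0) * L))"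
  shows "\<exists>R \<in> carrier_mat T n. X * R = 1\<^sub>m n \<and> U * R = L"
proof -
  obtain R where R: "R \<in> carrier_mat T n"
    and "(1\<^sub>m n - X * R)\<^sup>T * X + (L - U * R)\<^sup>T * U = 0\<^sub>m n T"
    using normal_equations[OF X U one_carrier_mat L] by blast
  \<comment> \<open>With the residuals transposed, the normal equations say exactly that
    \<open>(A0, B0)\<close> is such a direction.\<close>
  define A0 where "A0 = (1\<^sub>m n - X * R)\<^sup>T"
  define B0 where "B0 = (L - U * R)\<^sup>T"
  have A0: "A0 \<in> carrier_mat n n" and B0: "B0 \<in> carrier_mat n m"
    using X U R L by (auto simp: A0_def B0_def)
  have ker: "A0 * X + B0 * U = 0\<^sub>m n T"
    unfolding A0_def B0_def by fact
  have one: "1\<^sub>m n = A0\<^sup>T + X * R"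
    using X R by (intro eq_matI) (auto simp: A0_def)
  have L_eq: "L = B0\<^sup>T + U * R"
    using U R L by (intro eq_matI) (auto simp: B0_def)
  have trace0: "mat_trace (A0 + B0 * L) = 0"
  proof (rule mat_trace_direction_eq_0)
    fix t
    \<comment> \<open>These directions form a linear space, so stability holds along the whole
      line.\<close>
    have "(t \<cdot>\<^sub>m A0) * X + (t \<cdot>\<^sub>m B0) * U = t \<cdot>\<^sub>m (A0 * X + B0 * U)"
      using A0 B0 X U by (simp add: add_smult_distrib_left_mat[of _ n T] mult_smult_assoc_mat[of _ n _ _ T])
    then have "(t \<cdot>\<^sub>m A0) * X + (t \<cdot>\<^sub>m B0) * U = 0\<^sub>m n T" by (simp add: ker)
    then have "schur_stable (cmat ((A + t \<cdot>\<^sub>m A0) + (B + t \<cdot>\<^sub>m B0) * L))"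
      using A0 B0 by (intro stable) auto
    also have "(A + t \<cdot>\<^sub>m A0) + (B + t \<cdot>\<^sub>m B0) * L = (A + B * L) + t \<cdot>\<^sub>m (A0 + B0 * L)"
      using A B A0 B0 L
      by (intro eq_matI) (auto simp: add_mult_distrib_mat[of _ n m] mult_smult_assoc_mat[of _ n m] algebra_simps
        simp del: index_mult_mat(1))
    finally show "schur_stable (cmat ((A + B * L) + t \<cdot>\<^sub>m (A0 + B0 * L)))" .
  qed (use A B A0 B0 L in auto)
  \<comment> \<open>Writing \<open>1\<^sub>m n\<close> and \<open>L\<close> as fit plus residual
    splits off the two Gram matrices; the remaining terms combine to
    \<open>(A0 * X + B0 * U) * R\<close>, which is zero.\<close>
  have "A0 + B0 * L = A0 * (A0\<^sup>T + X * R) + B0 * (B0\<^sup>T + U * R)"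
    unfolding one[symmetric] L_eq[symmetric] using A0 by simp
  also have "\<dots> = (A0 * A0\<^sup>T + A0 * X * R) + (B0 * B0\<^sup>T + B0 * U * R)"
    using A0 B0 X U R
    by (simp add: mult_add_distrib_mat[of _ n n _ n] mult_add_distrib_mat[of _ n m _ n]
      assoc_mult_mat[of _ n n _ T _ n] assoc_mult_mat[of _ n m _ T _ n])
  also have "\<dots> = (A0 * A0\<^sup>T + B0 * B0\<^sup>T) + (A0 * X + B0 * U) * R"
    using A0 B0 X U R
    by (intro eq_matI) (auto simp: add_mult_distrib_mat[of _ n T] simp del: index_mult_mat(1))
  also have "\<dots> = A0 * A0\<^sup>T + B0 * B0\<^sup>T"
    unfolding ker using A0 B0 R by simp
  finally have "mat_trace (A0 * A0\<^sup>T) + mat_trace (B0 * B0\<^sup>T) = 0"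
    using trace0 A0 B0 by (simp add: mat_trace_add[of _ n])
  moreover have "mat_trace (A0 * A0\<^sup>T) \<ge> 0" "mat_trace (B0 * B0\<^sup>T) \<ge> 0"
    unfolding mat_trace_self_transpose[OF A0] mat_trace_self_transpose[OF B0]
    by (simp_all add: sum_nonneg)
  ultimately have "A0 = 0\<^sub>m n n" "B0 = 0\<^sub>m n m"
    using A0 B0 by (auto intro: mat_trace_self_transpose_eq_0)
  then have "1\<^sub>m n = X * R" "L = U * R"
    using one L_eq X U R by auto
  with R show ?thesis by metis
qed

section \<open>Placing the simple eigenvalue first\<close>

text \<open>Splitting off the factor of \<open>\<mu>\<close> once leaves a cofactor \<open>q\<close>
  that does not vanish at \<open>\<mu>\<close>; the complex roots of \<open>q\<close> fill the
  diagonal from position \<open>1\<close> on.\<close>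

lemma simple_eigenvalue_triangularize:
  assumes C: "C \<in> carrier_mat p p" and order: "Polynomial.order \<mu> (char_poly C) = 1"
  shows "\<exists>B P Q. similar_mat_wit (cmat C) B P Q \<and> upper_triangular B \<and>
    (\<forall>i. 0 < i \<and> i < p \<longrightarrow> B $$ (i, i) \<in> eigvals C - {complex_of_real \<mu>})"
proof -
  interpret map_poly_hom: map_poly_comm_ring_hom complex_of_real ..
  have cC: "cmat C \<in> carrier_mat p p" using C by simp
  have monic: "lead_coeff (char_poly C) = 1" "char_poly C \<noteq> 0"
    using degree_monic_char_poly[OF C] by auto
  obtain q where q: "char_poly C = [:- \<mu>, 1:] * q" "\<not> [:- \<mu>, 1:] dvd q"
    using order_decomp[OF monic(2), of \<mu>] order by auto
  define q' where "q' = map_poly complex_of_real q"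
  have lead: "lead_coeff q' = 1"
    using monic(1) unfolding q(1) lead_coeff_mult q'_def by simp
  obtain es where "Polynomial.smult (lead_coeff q') (\<Prod>e\<leftarrow>es. [:- e, 1:]) = q'"
    using fundamental_theorem_algebra_factorized[of q'] by blast
  then have es: "q' = (\<Prod>e\<leftarrow>es. [:- e, 1:])" using lead by simp
  have cp: "char_poly (cmat C) = [:- complex_of_real \<mu>, 1:] * q'"
    unfolding of_real_hom.char_poly_hom[OF C] q(1) q'_def map_poly_hom.hom_mult by simp
  then have "char_poly (cmat C) = (\<Prod>e\<leftarrow>complex_of_real \<mu> # es. [:- e, 1:])"
    by (simp add: es)
  then obtain B P Q where B: "similar_mat_wit (cmat C) B P Q" "upper_triangular B"
    "diag_mat B = complex_of_real \<mu> # es"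
    by (rule triangularize[OF cC])
  have Bc: "B \<in> carrier_mat p p" using similar_mat_witD2[OF cC B(1)] by blast
  have "B $$ (i, i) \<in> eigvals C - {complex_of_real \<mu>}" if i: "0 < i" "i < p" for i
  proof -
    have "B $$ (i, i) = (complex_of_real \<mu> # es) ! i" "length (diag_mat B) = p"
      unfolding B(3)[symmetric] using Bc i by (auto simp: diag_mat_def)
    then have mem: "B $$ (i, i) \<in> set es"
      using i unfolding B(3) by (cases i) auto
    then have root: "poly q' (B $$ (i, i)) = 0"
      unfolding es poly_prod_list by (auto simp: prod_list_zero_iff)
    then have "B $$ (i, i) \<in> eigvals C"
      unfolding eigvals_def spectrum_root_char_poly[OF cC] cp by simp
    \<comment> \<open>At a real point \<open>q'\<close> takes the value of \<open>q\<close>, so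
      non-divisibility over the reals suffices.\<close>
    moreover have "poly q' (complex_of_real \<mu>) \<noteq> 0"
      using q(2) unfolding q'_def by (simp add: poly_eq_0_iff_dvd)
    ultimately show ?thesis using root by auto
  qed
  with B show ?thesis by blast
qed

section \<open>From the Kronecker form to individual agents\<close>

lemma sum_blocks:
  fixes f :: "nat \<Rightarrow> 'a :: comm_monoid_add"
  shows "(\<Sum>c<p * n. f c) = (\<Sum>b<p. \<Sum>s<n. f (b * n + s))"
proof -
  have "(\<Sum>c<p * n. f c) = (\<Sum>b<p. \<Sum>c\<in>{b * n..<b * n + n}. f c)"
    by (rule sum.nat_group[symmetric])
  also have "\<dots> = (\<Sum>b<p. \<Sum>s<n. f (b * n + s))"
  proof (rule sum.cong)
    fix b assume "b \<in> {..<p}"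
    show "(\<Sum>c\<in>{b * n..<b * n + n}. f c) = (\<Sum>s<n. f (b * n + s))"
      by (rule sum.reindex_bij_witness[of _ "\<lambda>s. b * n + s" "\<lambda>c. c - b * n"]) auto
  qed simp
  finally show ?thesis .
qed

lemma index_mult_mat_vec_sum:
  assumes "A \<in> carrier_mat n m" "v \<in> carrier_vec m" "i < n"
  shows "(A *\<^sub>v v) $ i = (\<Sum>k<m. A $$ (i, k) * v $ k)"
  using assms by (simp add: scalar_prod_def atLeast0LessThan)

text \<open>Position \<open>a * n + r\<close> of the stacked state is component \<open>r\<close> of
  agent \<open>a\<close>; division and remainder by \<open>n\<close> recover the pair, so the
  network equation separates into agent equations.\<close>

lemma trajectory_kronecker_blocks:
  assumes C: "C \<in> carrier_mat p p" and A: "A \<in> carrier_mat n n" and G: "G \<in> carrier_mat n n"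
    and X: "trajectory (1\<^sub>m p \<otimes>\<^sub>K A + C \<otimes>\<^sub>K G) X" and a: "a < p" and r: "r < n"
  shows "X (Suc k) $ (a * n + r) = (\<Sum>s<n. A $$ (r, s) * X k $ (a * n + s)) +
    (\<Sum>b<p. C $$ (a, b) * (\<Sum>s<n. G $$ (r, s) * X k $ (b * n + s)))"
proof -
  let ?N = "1\<^sub>m p \<otimes>\<^sub>K A + C \<otimes>\<^sub>K G"
  have idx: "b * n + s < p * n" if "b < p" "s < n" for b s
  proof -
    have "b * n + s < Suc b * n" using that by simp
    also have "\<dots> \<le> p * n" using that by (intro mult_le_mono1) auto
    finally show ?thesis .
  qed
  have N: "?N \<in> carrier_mat (p * n) (p * n)"
    using A C G by (auto simp: kronecker_def)
  have entry: "?N $$ (a * n + r, b * n + s) = (if a = b then A $$ (r, s) else 0) + C $$ (a, b) * G $$ (r, s)"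
    if "b < p" "s < n" for b s
    using A C G a r that idx[OF a r] idx[OF that]
    by (simp add: kronecker_def)
  have Xk: "X k \<in> carrier_vec (p * n)" and "X (Suc k) = ?N *\<^sub>v X k"
    using X N by (auto simp: trajectory_def)
  then have "X (Suc k) $ (a * n + r) = (\<Sum>c<p * n. ?N $$ (a * n + r, c) * X k $ c)"
    using index_mult_mat_vec_sum[OF N _ idx[OF a r]] by simp
  also have "\<dots> = (\<Sum>b<p. \<Sum>s<n. (if a = b then A $$ (r, s) * X k $ (b * n + s) else 0) +
      C $$ (a, b) * (G $$ (r, s) * X k $ (b * n + s)))"
    unfolding sum_blocks by (intro sum.cong refl) (auto simp: entry distrib_right mult.assoc)
  also have "\<dots> = (\<Sum>b<p. if a = b then \<Sum>s<n. A $$ (r, s) * X k $ (b * n + s) else 0) +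
      (\<Sum>b<p. C $$ (a, b) * (\<Sum>s<n. G $$ (r, s) * X k $ (b * n + s)))"
    unfolding sum.distrib sum_distrib_left by (intro arg_cong2[where f = plus] sum.cong refl) auto
  finally show ?thesis using a by simp
qed

lemma synchronized_network_mat:
  assumes C: "C \<in> carrier_mat p p" and A: "A \<in> carrier_mat n n"
    and B: "B \<in> carrier_mat n m" and K: "K \<in> carrier_mat m n"
    and ones: "eigenvector C (ones_vec p) \<mu>" and order: "Polynomial.order \<mu> (char_poly C) = 1"
    and stable: "\<And>z. z \<in> eigvals C - {complex_of_real \<mu>} \<Longrightarrow> schur_stable (cmat A + z \<cdot>\<^sub>m cmat (B * K))"
  shows "synchronized p n (network_mat p C A B K)"
  unfolding synchronized_def
proof (intro allI impI)
  fix X a b r assume X: "trajectory (network_mat p C A B K) X" and a: "a < p" and b: "b < p" and r: "r < n"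
  define G where "G = B * K"
  have G: "G \<in> carrier_mat n n" using B K by (simp add: G_def)
  have X': "trajectory (1\<^sub>m p \<otimes>\<^sub>K A + C \<otimes>\<^sub>K G) X"
    using X by (simp add: network_mat_def G_def)
  obtain D P Q where D: "similar_mat_wit (cmat C) D P Q" "upper_triangular D"
    and diag: "\<And>i. 0 < i \<Longrightarrow> i < p \<Longrightarrow> D $$ (i, i) \<in> eigvals C - {complex_of_real \<mu>}"
    using simple_eigenvalue_triangularize[OF C order] by blast
  \<comment> \<open>Reads the eigenvector equation for the all-ones vector row by row.\<close>
  have row_sum: "(\<Sum>b<p. C $$ (a, b)) = \<mu>" if "a < p" for a
  proof -
    have "(C *\<^sub>v ones_vec p) $ a = (\<mu> \<cdot>\<^sub>v ones_vec p) $ a"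
      using ones by (simp add: eigenvector_def)
    then show ?thesis
      using C that by (simp add: ones_vec_def scalar_prod_def atLeast0LessThan)
  qed
  \<comment> \<open>Triangularization takes place over the complex numbers, so the real trajectory
    is embedded and the limit is pulled back at the end.\<close>
  define \<xi> where "\<xi> k a r = complex_of_real (X k $ (a * n + r))" for k a r
  have "(\<lambda>k. \<xi> k a r - \<xi> k b r) \<longlonglongrightarrow> 0"
  proof (rule coupled_recursion_synchronizes[where A = "cmat A" and G = "cmat G" and \<mu> = "complex_of_real \<mu>"])
    show "(\<Sum>b<p. cmat C $$ (a, b)) = complex_of_real \<mu>" if "a < p" for a
      using C that by (simp flip: row_sum)
    show "\<xi> (Suc k) a r = (\<Sum>s<n. cmat A $$ (r, s) * \<xi> k a s) +
        (\<Sum>b<p. cmat C $$ (a, b) * (\<Sum>s<n. cmat G $$ (r, s) * \<xi> k b s))"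
      if "a < p" "r < n" for k a r
      unfolding \<xi>_def trajectory_kronecker_blocks[OF C A G X' that]
      using A C G that by simp
  qed (use A G C D diag stable[folded G_def] a b r in auto)
  then have "(\<lambda>k. complex_of_real (X k $ (a * n + r) - X k $ (b * n + r))) \<longlonglongrightarrow> 0"
    by (simp add: \<xi>_def)
  then have "(\<lambda>k. X k $ (a * n + r) - X k $ (b * n + r)) \<longlonglongrightarrow> 0"
    using tendsto_of_real_iff[of _ 0] by fastforce
  then show "(\<lambda>k. (block n a (X k) - block n b (X k)) $ r) \<longlonglongrightarrow> 0"
    using r by (simp add: block_def)
qed

section \<open>Informativity in terms of right inverses, and the synchronizing gain\<close>

theorem theorem6:
  fixes p n m T l :: nat
    and C A_true B_true :: "real mat"
    and \<mu> :: real
    and lam :: "nat \<Rightarrow> real"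
    and u x :: "nat \<Rightarrow> real vec"
  assumes "p \<ge> 2" and "n \<ge> 1" and "m \<ge> 1" and "T \<ge> 1"
    and "C \<in> carrier_mat p p"
    and "eigenvector C (ones_vec p) \<mu>"
    and "Polynomial.order \<mu> (char_poly C) = 1"
    and "\<forall>z \<in> eigvals C - {complex_of_real \<mu>}. z \<in> \<real> \<and> Re z > 0"
    and "bij_betw (\<lambda>i. complex_of_real (lam i)) {1..l} (eigvals C - {complex_of_real \<mu>})"
    and "A_true \<in> carrier_mat n n" and "B_true \<in> carrier_mat n m"
    and "\<forall>k < T. u k \<in> carrier_vec m"
    and "\<forall>k \<le> T. x k \<in> carrier_vec n"
    and "\<forall>k < T. x (Suc k) = A_true *\<^sub>v x k + B_true *\<^sub>v u k"
  shows "(informative_sync n m T u x C \<mu> \<longleftrightarrow>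
            full_row_rank (X_minus n T x) \<and>
            (\<exists>R. sync_right_inverses (U_minus m T u) (X_minus n T x) (X_plus n T x) l lam R)) \<and>
         (\<forall>R. sync_right_inverses (U_minus m T u) (X_minus n T x) (X_plus n T x) l lam R \<longrightarrow>
            (\<forall>(A, B) \<in> consistent_systems n m T u x.
               synchronized p n
                 (network_mat p C A B ((1 / lam 1) \<cdot>\<^sub>m (U_minus m T u * R 1)))))"
proof -
  let ?U = "U_minus m T u" and ?X = "X_minus n T x" and ?Y = "X_plus n T x"
  let ?E = "eigvals C - {complex_of_real \<mu>}"
  let ?K = "\<lambda>R. (1 / lam 1) \<cdot>\<^sub>m (?U * R (1::nat))"
  note C = assms(5)
  have U: "?U \<in> carrier_mat m T" and X: "?X \<in> carrier_mat n T" and Y: "?Y \<in> carrier_mat n T"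
    by (auto simp: U_minus_def X_minus_def X_plus_def)
  \<comment> \<open>Gives a base point in the set of consistent systems, from which the necessity
    argument perturbs.\<close>
  have true_consistent: "(A_true, B_true) \<in> consistent_systems n m T u x"
  proof -
    have "?Y = A_true * ?X + B_true * ?U"
    proof (rule eq_matI)
      fix i j assume ij: "i < dim_row (A_true * ?X + B_true * ?U)" "j < dim_col (A_true * ?X + B_true * ?U)"
      then have ij: "i < n" "j < T" using assms(11) U by auto
      have "col ?X j = x j" "col ?U j = u j"
        using ij assms(12,13) by (auto simp: X_minus_def U_minus_def intro!: col_mat_of_cols)
      \<comment> \<open>The columns of \<open>?Y\<close> start at time \<open>1\<close>, hence the
        shift by one.\<close>
      moreover have "?Y $$ (i, j) = x (Suc j) $ i"
        using ij by (auto simp: X_plus_def mat_of_cols_index simp del: upt_Suc)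
      moreover have "x (Suc j) = A_true *\<^sub>v x j + B_true *\<^sub>v u j"
        using assms(14) ij by blast
      ultimately show "?Y $$ (i, j) = (A_true * ?X + B_true * ?U) $$ (i, j)"
        using ij assms(10,11) X U by simp
    qed (use assms(11) U Y in auto)
    then show ?thesis using assms(10,11) by (simp add: consistent_systems_def)
  qed
  have E: "complex_of_real (lam i) \<in> ?E" if "i \<in> {1..l}" for i
    using bij_betwE[OF assms(9)] that by blast
  have lam_pos: "lam i > 0" if "i \<in> {1..l}" for i
    using bspec[OF assms(8) E[OF that]] by simp
  \<comment> \<open>Since \<open>p\<close> is at least 2, the diagonal has a position
    \<open>1\<close>, whose entry is an eigenvalue other than \<open>\<mu>\<close>; so
    \<open>lam 1\<close> and \<open>R 1\<close> belong to the indexed family.\<close>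
  have l: "1 \<in> {1..l}"
  proof -
    obtain D P Q where "\<forall>i. 0 < i \<and> i < p \<longrightarrow> D $$ (i, i) \<in> ?E"
      using simple_eigenvalue_triangularize[OF C assms(7)] by blast
    then have "D $$ (1, 1) \<in> ?E" using assms(1) by auto
    then have "{1..l} \<noteq> {}" using assms(9) by (auto simp: bij_betw_def)
    then show ?thesis by simp
  qed
  \<comment> \<open>Serves both the sufficiency of (b) and the synchronization claim.\<close>
  have stable: "?K R \<in> carrier_mat m n \<and>
      (\<forall>z\<in>?E. \<forall>(A, B) \<in> consistent_systems n m T u x. schur_stable (cmat A + z \<cdot>\<^sub>m cmat (B * ?K R)))"
    if R: "sync_right_inverses ?U ?X ?Y l lam R" for R
  proof (intro conjI ballI, goal_cases)
    case 1
    then show ?case using R l U X by (auto simp: sync_right_inverses_def right_inverse_def)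
  next
    case (2 z S)
    obtain A B where S: "S = (A, B)" by fastforce
    with 2 have A: "A \<in> carrier_mat n n" and B: "B \<in> carrier_mat n m" and eq: "?Y = A * ?X + B * ?U"
      by (auto simp: consistent_systems_def)
    obtain i where i: "i \<in> {1..l}" and z: "z = complex_of_real (lam i)"
      using 2(1) unfolding bij_betw_imp_surj_on[OF assms(9), symmetric] by blast
    have Rc: "R j \<in> carrier_mat T n" and XR: "?X * R j = 1\<^sub>m n" if "j \<in> {1..l}" for j
      using R that X by (auto simp: sync_right_inverses_def right_inverse_def inverts_mat_def)
    have "?U * (lam 1 \<cdot>\<^sub>m R i - lam i \<cdot>\<^sub>m R 1) = 0\<^sub>m m n"
      using R l i U X by (auto simp: sync_right_inverses_def)
    moreover have "?U * (lam 1 \<cdot>\<^sub>m R i - lam i \<cdot>\<^sub>m R 1) = lam 1 \<cdot>\<^sub>m (?U * R i) - lam i \<cdot>\<^sub>m (?U * R 1)"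
      using Rc[OF i] Rc[OF l] U
      by (simp add: mult_minus_distrib_mat[of _ m T _ n] mult_smult_distrib[of _ m T _ n])
    ultimately have diff: "lam 1 \<cdot>\<^sub>m (?U * R i) - lam i \<cdot>\<^sub>m (?U * R 1) = 0\<^sub>m m n" by simp
    \<comment> \<open>Condition (b) for the pair \<open>(1, i)\<close>, divided by the positive
      \<open>lam 1\<close>.\<close>
    have UR: "?U * R i = lam i \<cdot>\<^sub>m ?K R"
    proof (rule eq_matI)
      fix a b assume "a < dim_row (lam i \<cdot>\<^sub>m ?K R)" "b < dim_col (lam i \<cdot>\<^sub>m ?K R)"
      then have ab: "a < m" "b < n" using U Rc[OF l] by auto
      have "(lam 1 \<cdot>\<^sub>m (?U * R i) - lam i \<cdot>\<^sub>m (?U * R 1)) $$ (a, b) = 0"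
        unfolding diff using ab by simp
      then have "lam 1 * (?U * R i) $$ (a, b) = lam i * (?U * R 1) $$ (a, b)"
        using ab U Rc[OF i] Rc[OF l] by (simp del: index_mult_mat(1))
      then show "(?U * R i) $$ (a, b) = (lam i \<cdot>\<^sub>m ?K R) $$ (a, b)"
        using ab U Rc[OF i] Rc[OF l] lam_pos[OF l] by (simp add: field_simps del: index_mult_mat(1))
    qed (use U Rc[OF i] Rc[OF l] in auto)
    have Kc: "?K R \<in> carrier_mat m n" using U Rc[OF l] by simp
    have "?Y * R i = A * ?X * R i + B * ?U * R i"
      unfolding eq using A B X U Rc[OF i] by (simp add: add_mult_distrib_mat[of _ n T])
    also have "\<dots> = A + B * (lam i \<cdot>\<^sub>m ?K R)"
      using A B X U Rc[OF i] XR[OF i]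
      by (simp add: assoc_mult_mat[of A n n ?X T "R i" n] assoc_mult_mat[of B n m ?U T "R i" n] UR)
    also have "\<dots> = A + lam i \<cdot>\<^sub>m (B * ?K R)"
      using B Kc by (simp only: mult_smult_distrib)
    finally have "cmat (?Y * R i) = cmat A + z \<cdot>\<^sub>m cmat (B * ?K R)"
      using A B Kc by (intro eq_matI) (auto simp: z simp del: index_mult_mat(1))
    moreover have "schur_stable (cmat (?Y * R i))"
      using R i by (simp add: sync_right_inverses_def)
    ultimately show ?case by (simp add: S)
  qed
  have "informative_sync n m T u x C \<mu>" if "sync_right_inverses ?U ?X ?Y l lam R" for R
    using stable[OF that] unfolding informative_sync_def by blast
  moreover have "full_row_rank ?X \<and> (\<exists>R. sync_right_inverses ?U ?X ?Y l lam R)"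
    if informative: "informative_sync n m T u x C \<mu>"
  proof -
    obtain K where K: "K \<in> carrier_mat m n" and
      K_stable: "\<And>z A B. z \<in> ?E \<Longrightarrow> (A, B) \<in> consistent_systems n m T u x \<Longrightarrow>
        schur_stable (cmat A + z \<cdot>\<^sub>m cmat (B * K))"
      using informative unfolding informative_sync_def by fast
    \<comment> \<open>As \<open>lam i\<close> is real, it can be absorbed into the gain, and the
      closed loop is the image of a real matrix.\<close>
    have K_stable_real: "schur_stable (cmat (A + B * (lam i \<cdot>\<^sub>m K)))"
      if i: "i \<in> {1..l}" and AB: "(A, B) \<in> consistent_systems n m T u x" for i A B
    proof -
      have "A \<in> carrier_mat n n" "B \<in> carrier_mat n m"
        using AB by (auto simp: consistent_systems_def)
      then have "cmat (A + B * (lam i \<cdot>\<^sub>m K)) = cmat A + complex_of_real (lam i) \<cdot>\<^sub>m cmat (B * K)"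
        using K by (intro eq_matI) (auto simp: mult_smult_distrib[of _ n m] simp del: index_mult_mat(1))
      then show ?thesis using K_stable[OF E[OF i] AB] by simp
    qed
    \<comment> \<open>Each eigenvalue gets its own right inverse, from the family through the true
      system with \<open>L = lam i \<cdot>\<^sub>m K\<close>.\<close>
    have "\<exists>R \<in> carrier_mat T n. ?X * R = 1\<^sub>m n \<and> ?U * R = lam i \<cdot>\<^sub>m K" if i: "i \<in> {1..l}" for i
    proof (rule right_inverse_of_stable_family[OF assms(10,11) _ X U])
      fix A0 B0 assume A0: "A0 \<in> carrier_mat n n" and B0: "B0 \<in> carrier_mat n m"
        and ker: "A0 * ?X + B0 * ?U = 0\<^sub>m n T"
      have "(A_true + A0) * ?X + (B_true + B0) * ?U = (A_true * ?X + B_true * ?U) + (A0 * ?X + B0 * ?U)"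
        using assms(10,11) A0 B0 X U
        by (intro eq_matI) (auto simp: add_mult_distrib_mat[of _ n n] add_mult_distrib_mat[of _ n m]
          simp del: index_mult_mat(1))
      also have "\<dots> = ?Y"
        unfolding ker using true_consistent Y by (simp add: consistent_systems_def)
      finally have "(A_true + A0, B_true + B0) \<in> consistent_systems n m T u x"
        using assms(10,11) A0 B0 by (simp add: consistent_systems_def)
      then show "schur_stable (cmat ((A_true + A0) + (B_true + B0) * (lam i \<cdot>\<^sub>m K)))"
        by (rule K_stable_real[OF i])
    qed (use K in auto)
    then obtain R where Rc: "\<And>i. i \<in> {1..l} \<Longrightarrow> R i \<in> carrier_mat T n"
      and XR: "\<And>i. i \<in> {1..l} \<Longrightarrow> ?X * R i = 1\<^sub>m n"
      and UR: "\<And>i. i \<in> {1..l} \<Longrightarrow> ?U * R i = lam i \<cdot>\<^sub>m K"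
      by metis
    have "schur_stable (cmat (?Y * R i))" if i: "i \<in> {1..l}" for i
    proof -
      have "?Y * R i = A_true * ?X * R i + B_true * ?U * R i"
        using true_consistent assms(10,11) X U Rc[OF i]
        by (simp add: consistent_systems_def add_mult_distrib_mat[of _ n T])
      also have "\<dots> = A_true + B_true * (lam i \<cdot>\<^sub>m K)"
        using assms(10,11) X U Rc[OF i]
        by (simp add: assoc_mult_mat[of A_true n n ?X T "R i" n]
          assoc_mult_mat[of B_true n m ?U T "R i" n] XR[OF i] UR[OF i])
      finally show ?thesis using K_stable_real[OF i true_consistent] by simp
    qed
    \<comment> \<open>The gain \<open>K\<close> is common to all eigenvalues, so both terms equal
      \<open>lam i * lam j\<close> times \<open>K\<close>.\<close>
    moreover have "?U * (lam i \<cdot>\<^sub>m R j - lam j \<cdot>\<^sub>m R i) = 0\<^sub>m m n"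
      if i: "i \<in> {1..l}" and j: "j \<in> {1..l}" for i j
    proof -
      have "?U * (lam i \<cdot>\<^sub>m R j - lam j \<cdot>\<^sub>m R i) = lam i \<cdot>\<^sub>m (lam j \<cdot>\<^sub>m K) - lam j \<cdot>\<^sub>m (lam i \<cdot>\<^sub>m K)"
        using Rc[OF i] Rc[OF j] U
        by (simp add: mult_minus_distrib_mat[of _ m T _ n] mult_smult_distrib[of _ m T _ n] UR[OF i] UR[OF j])
      also have "\<dots> = 0\<^sub>m m n" using K by (intro eq_matI) auto
      finally show ?thesis .
    qed
    ultimately have "sync_right_inverses ?U ?X ?Y l lam R"
      using Rc XR X U by (auto simp: sync_right_inverses_def right_inverse_def inverts_mat_def)
    with full_row_rank_of_right_inverse[OF X Rc[OF l] XR[OF l]] show ?thesis by blast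
  qed
  moreover have "synchronized p n (network_mat p C A B (?K R))"
    if R: "sync_right_inverses ?U ?X ?Y l lam R" and AB: "(A, B) \<in> consistent_systems n m T u x" for R A B
  proof (rule synchronized_network_mat[OF C _ _ _ assms(6,7)])
    show "A \<in> carrier_mat n n" "B \<in> carrier_mat n m"
      using AB by (auto simp: consistent_systems_def)
    show "?K R \<in> carrier_mat m n" using stable[OF R] by blast
    show "schur_stable (cmat A + z \<cdot>\<^sub>m cmat (B * ?K R))" if "z \<in> ?E" for z
      using stable[OF R] that AB by blast
  qed
  ultimately show ?thesis by blast
qed

end
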